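(* Let $P$ be an ergodic Markov kernel on a finite state space $S$ with $|S|\ge2$ and stationary distribution $\pi$ of full support, and let $\varepsilon\in(0,1)$. If $0<\eta_{\mathrm{KL}}(P)<1$, then $$t_{\mathrm{mix}}(\varepsilon)\le\max\left\{0,\left\lceil\frac{\log\bigl(\frac{1}{2\varepsilon^2}\log(1/\pi_{\min})\bigr)}{-\log\eta_{\mathrm{KL}}(P)}\right\rceil\right\}.$$ If $\eta_{\mathrm{KL}}(P)=0$, then $t_{\mathrm{mix}}(\varepsilon)\le1$.
   Context: All logarithms are natural, with $0\log0=0$. $D_{\mathrm{KL}}(\mu\|\nu)=\sum_{x}\mu(x)\log\frac{\mu(x)}{\nu(x)}$, $(\mu P)(y)=\sum_x\mu(x)P(x,y)$, $\pi_{\min}:=\min_{x\in S}\pi(x)$. The KL contraction coefficient is $\eta_{\mathrm{KL}}(P):=\sup_{\mu\ne\pi}D_{\mathrm{KL}}(\mu P\|\pi)/D_{\mathrm{KL}}(\mu\|\pi)$, over all probability distributions $\mu\ne\pi$ on $S$. The total-variation mixing time is $t_{\mathrm{mix}}(\varepsilon):=\min\{t\ge0:\max_{x\in S}\|P^t(x,\cdot)-\pi\|_{\mathrm{TV}}\le\varepsilon\}$ with $t$ an integer and $\|\mu-\nu\|_{\mathrm{TV}}=\frac12\sum_{x\in S}|\mu(x)-\nu(x)|$. *)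

theory Defs
  imports "HOL-Probability.Probability"
begin

text \<open>
  The finite state space is a type of class \<open>finite\<close>. A Markov kernel is a function
  \<open>P :: 's \<Rightarrow> 's pmf\<close>, so that \<open>P(x,y)\<close> is \<open>pmf (P x) y\<close>, and the
  distribution \<open>\<mu>P\<close> is \<open>bind_pmf \<mu> P\<close>.
\<close>

primrec kernel_power :: "('s \<Rightarrow> 's pmf) \<Rightarrow> nat \<Rightarrow> 's \<Rightarrow> 's pmf" where
  "kernel_power P 0 x = return_pmf x"
| "kernel_power P (Suc t) x = bind_pmf (kernel_power P t x) P"

definition irreducible_kernel :: "('s \<Rightarrow> 's pmf) \<Rightarrow> bool" where
  "irreducible_kernel P \<longleftrightarrow> (\<forall>x y. \<exists>t. pmf (kernel_power P t x) y > 0)"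

definition aperiodic_kernel :: "('s \<Rightarrow> 's pmf) \<Rightarrow> bool" where
  "aperiodic_kernel P \<longleftrightarrow> (\<forall>x. Gcd {t. t > 0 \<and> pmf (kernel_power P t x) x > 0} = 1)"

definition ergodic_kernel :: "('s \<Rightarrow> 's pmf) \<Rightarrow> bool" where
  "ergodic_kernel P \<longleftrightarrow> irreducible_kernel P \<and> aperiodic_kernel P"

definition stationary :: "'s pmf \<Rightarrow> ('s \<Rightarrow> 's pmf) \<Rightarrow> bool" where
  "stationary \<pi> P \<longleftrightarrow> bind_pmf \<pi> P = \<pi>"

text \<open>
  Terms with \<open>\<mu>(x) = 0\<close> vanish, as required by \<open>0 log 0 = 0\<close>. The real-valued
  sum is the divergence only if \<open>\<mu>\<close> is absolutely continuous with respect to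
  \<open>\<nu>\<close>; below, \<open>\<nu>\<close> has full support, so this always holds.
\<close>

definition KL_div :: "'s::finite pmf \<Rightarrow> 's pmf \<Rightarrow> real" where
  "KL_div \<mu> \<nu> = (\<Sum>x\<in>UNIV. pmf \<mu> x * ln (pmf \<mu> x / pmf \<nu> x))"

text \<open>
  A supremum in the reals: for \<open>\<pi>\<close> stationary and of full support on at least two
  states, the set of ratios is nonempty, its denominators are positive, and it is bounded
  above by 1 by the data processing inequality.
\<close>

definition eta_KL :: "'s::finite pmf \<Rightarrow> ('s \<Rightarrow> 's pmf) \<Rightarrow> real" where
  "eta_KL \<pi> P = (SUP \<mu>\<in>{\<mu>. \<mu> \<noteq> \<pi>}. KL_div (bind_pmf \<mu> P) \<pi> / KL_div \<mu> \<pi>)"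

definition TV_dist :: "'s::finite pmf \<Rightarrow> 's pmf \<Rightarrow> real" where
  "TV_dist \<mu> \<nu> = 1 / 2 * (\<Sum>x\<in>UNIV. \<bar>pmf \<mu> x - pmf \<nu> x\<bar>)"

text \<open>
  The minimum is over a nonempty set when \<open>P\<close> is ergodic with stationary distribution
  \<open>\<pi>\<close> and \<open>\<epsilon> > 0\<close>, by the convergence theorem.
\<close>

definition t_mix :: "'s::finite pmf \<Rightarrow> ('s \<Rightarrow> 's pmf) \<Rightarrow> real \<Rightarrow> nat" where
  "t_mix \<pi> P \<epsilon> = (LEAST t. (MAX x. TV_dist (kernel_power P t x) \<pi>) \<le> \<epsilon>)"

definition pi_min :: "'s::finite pmf \<Rightarrow> real" where
  "pi_min \<pi> = (MIN x. pmf \<pi> x)"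

end

theory Submission
  imports Defs
begin

text \<open>
  Data processing bounds the ratios that define \<open>\<eta>\<close>, so each step contracts the divergence
  to \<open>\<pi>\<close> by \<open>\<eta>\<close>. A point mass has divergence at most \<open>ln (1 / \<pi>\<^sub>m\<^sub>i\<^sub>n)\<close>, and Pinsker's
  inequality turns \<open>\<eta> ^ t * ln (1 / \<pi>\<^sub>m\<^sub>i\<^sub>n) \<le> 2 * \<epsilon>\<^sup>2\<close> into a bound on the total variation.
\<close>

section \<open>Pinsker's inequality\<close>

text \<open>The derivative is \<open>(x - 1)\<^sup>2 / (x * (x + 1)\<^sup>2)\<close>. As the
  function vanishes at 1, monotonicity gives its sign on either side of 1.\<close>

lemma mono_ln_minus_moebius:
  fixes u v :: real
  assumes "0 < u" "u \<le> v"
  shows "ln u - 2 * (u - 1) / (u + 1) \<le> ln v - 2 * (v - 1) / (v + 1)"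
proof (rule DERIV_nonneg_imp_nondecreasing[OF assms(2)])
  fix x assume "u \<le> x" "x \<le> v"
  then have x: "x > 0" using assms by linarith
  have "(x - 1)\<^sup>2 / (x * (x + 1)\<^sup>2) = 1 / x - 4 / (x + 1)\<^sup>2"
    using x by (simp add: divide_simps) (simp add: power2_eq_square algebra_simps)
  moreover have "((\<lambda>x. ln x - 2 * (x - 1) / (x + 1)) has_real_derivative
      1 / x - 4 / (x + 1)\<^sup>2) (at x)"
    using x by (auto intro!: derivative_eq_intros simp: power2_eq_square)
  moreover have "(x - 1)\<^sup>2 / (x * (x + 1)\<^sup>2) \<ge> 0" using x by simp
  ultimately show "\<exists>y. ((\<lambda>x. ln x - 2 * (x - 1) / (x + 1)) has_real_derivative y) (at x) \<and> 0 \<le> y"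
    by metis
qed

text \<open>Right side minus left side vanishes at 1, and its derivative is
  \<open>4 * (x + 1)\<close> times the function of the previous lemma. So it falls before 1 and
  rises after 1. At \<open>u = 0\<close> the claim is 3 \<le> 4.\<close>

lemma pinsker_pointwise:
  fixes u :: real
  assumes "u \<ge> 0"
  shows "3 * (u - 1)\<^sup>2 \<le> (2 * u + 4) * (u * ln u - u + 1)"
proof (cases "u = 0")
  case False
  with assms have u: "u > 0" by simp
  define g :: "real \<Rightarrow> real" where "g x = (2 * x + 4) * (x * ln x - x + 1) - 3 * (x - 1)\<^sup>2" for x
  have der: "(g has_real_derivative 4 * (x + 1) * (ln x - 2 * (x - 1) / (x + 1))) (at x)"
    if "x > 0" for x
  proof -
    have "4 * (x + 1) * (ln x - 2 * (x - 1) / (x + 1)) = (4 * x + 4) * ln x - 8 * (x - 1)"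
      using that by (simp add: field_simps)
    then show ?thesis unfolding g_def using that
      by (auto intro!: derivative_eq_intros simp: algebra_simps)
  qed
  have "g 1 \<le> g u"
  proof (cases "u \<ge> 1")
    case True
    show ?thesis
    proof (rule DERIV_nonneg_imp_nondecreasing[OF True])
      fix x assume "1 \<le> x" "x \<le> u"
      then show "\<exists>y. (g has_real_derivative y) (at x) \<and> 0 \<le> y"
        using der[of x] mono_ln_minus_moebius[of 1 x]
        by (intro exI[of _ "4 * (x + 1) * (ln x - 2 * (x - 1) / (x + 1))"]) auto
    qed
  next
    case False
    then have "u \<le> 1" by simp
    then show ?thesis
    proof (rule DERIV_nonpos_imp_nonincreasing)
      fix x assume "u \<le> x" "x \<le> 1"
      then show "\<exists>y. (g has_real_derivative y) (at x) \<and> y \<le> 0"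
        using u der[of x] mono_ln_minus_moebius[of x 1]
        by (intro exI[of _ "4 * (x + 1) * (ln x - 2 * (x - 1) / (x + 1))"])
          (auto intro!: mult_nonneg_nonpos)
    qed
  qed
  then show ?thesis by (simp add: g_def)
qed simp

lemma sum_pmf_UNIV: "(\<Sum>x\<in>UNIV. pmf (\<mu> :: 's::finite pmf) x) = 1"
  by (rule sum_pmf_eq_1) auto

lemma pmf_bind_finite:
  fixes \<mu> :: "'s::finite pmf"
  shows "pmf (bind_pmf \<mu> P) y = (\<Sum>x\<in>UNIV. pmf \<mu> x * pmf (P x) y)"
  unfolding pmf_bind by (subst integral_measure_pmf[of UNIV]) auto

lemma pmf_pos_full_support: "set_pmf \<pi> = UNIV \<Longrightarrow> pmf \<pi> x > 0"
  by (metis UNIV_I pmf_positive)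

text \<open>Cauchy-Schwarz: the pointwise inequality at the likelihood ratio, scaled by the square
  of \<nu>(x), bounds \<open>\<bar>pmf \<mu> x - pmf \<nu> x\<bar>\<^sup>2\<close> by
  \<open>a x * b x\<close>.\<close>

lemma pinsker:
  fixes \<mu> \<nu> :: "'s::finite pmf"
  assumes "set_pmf \<nu> = UNIV"
  shows "(TV_dist \<mu> \<nu>)\<^sup>2 \<le> KL_div \<mu> \<nu> / 2"
proof -
  note pos = pmf_pos_full_support[OF assms]
  \<comment> \<open>The sum of \<open>a\<close> is (2 + 4) / 3 = 2. The correction
    \<open>- pmf \<mu> x + pmf \<nu> x\<close> makes each \<open>b x\<close> nonnegative and sums to
    0, so \<open>b\<close> still sums to the divergence.\<close>
  define a where "a x = (2 * pmf \<mu> x + 4 * pmf \<nu> x) / 3" for x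
  define b where "b x = pmf \<mu> x * ln (pmf \<mu> x / pmf \<nu> x) - pmf \<mu> x + pmf \<nu> x" for x
  have ab: "\<bar>pmf \<mu> x - pmf \<nu> x\<bar>\<^sup>2 \<le> a x * b x \<and> 0 \<le> a x \<and> 0 \<le> b x" for x
  proof -
    define u where "u = pmf \<mu> x / pmf \<nu> x"
    define q where "q = pmf \<nu> x"
    have q: "q > 0" using pos q_def by simp
    have p: "pmf \<mu> x = q * u" using q by (simp add: u_def q_def)
    have u: "u \<ge> 0" by (simp add: u_def)
    have P: "3 * (u - 1)\<^sup>2 \<le> (2 * u + 4) * (u * ln u - u + 1)" by (rule pinsker_pointwise[OF u])
    have a: "a x = q * ((2 * u + 4) / 3)" by (simp add: a_def p q_def[symmetric] algebra_simps)
    have b: "b x = q * (u * ln u - u + 1)"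
      unfolding b_def u_def[symmetric] q_def[symmetric] p by (simp add: algebra_simps)
    have "0 \<le> (2 * u + 4) * (u * ln u - u + 1)"
      using P zero_le_power2[of "u - 1"] by linarith
    then have h: "0 \<le> u * ln u - u + 1" using u by (simp add: zero_le_mult_iff)
    have "\<bar>pmf \<mu> x - pmf \<nu> x\<bar>\<^sup>2 = q\<^sup>2 * (u - 1)\<^sup>2"
      unfolding p q_def[symmetric] by (simp add: power2_eq_square algebra_simps)
    also have "\<dots> \<le> q\<^sup>2 * ((2 * u + 4) * (u * ln u - u + 1) / 3)"
      using P by (intro mult_left_mono) auto
    also have "\<dots> = a x * b x" unfolding a b by (simp add: power2_eq_square)
    finally have "\<bar>pmf \<mu> x - pmf \<nu> x\<bar>\<^sup>2 \<le> a x * b x" .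
    moreover have "0 \<le> a x" "0 \<le> b x" by (simp_all add: a_def b h q less_imp_le)
    ultimately show ?thesis by blast
  qed
  have "(\<Sum>x\<in>UNIV. \<bar>pmf \<mu> x - pmf \<nu> x\<bar>)\<^sup>2 \<le> (\<Sum>x\<in>UNIV. sqrt (a x) * sqrt (b x))\<^sup>2"
    using ab by (intro power_mono sum_mono sum_nonneg)
      (auto simp: real_sqrt_mult[symmetric] intro!: real_le_rsqrt)
  also have "\<dots> \<le> (\<Sum>x\<in>UNIV. (sqrt (a x))\<^sup>2) * (\<Sum>x\<in>UNIV. (sqrt (b x))\<^sup>2)"
    by (rule Cauchy_Schwarz_ineq_sum)
  also have "\<dots> = (\<Sum>x\<in>UNIV. a x) * (\<Sum>x\<in>UNIV. b x)" using ab by simp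
  also have "(\<Sum>x\<in>UNIV. a x) = 2"
    by (simp add: a_def sum_divide_distrib[symmetric] sum.distrib sum_distrib_left[symmetric] sum_pmf_UNIV)
  also have "(\<Sum>x\<in>UNIV. b x) = KL_div \<mu> \<nu>"
    by (simp add: b_def KL_div_def sum.distrib sum_subtractf sum_pmf_UNIV)
  finally show ?thesis by (simp add: TV_dist_def power_mult_distrib power2_eq_square)
qed

text \<open>By Pinsker, since total variation separates distinct distributions. This makes the
  denominators in \<open>eta_KL\<close> positive.\<close>

lemma KL_div_pos:
  fixes \<mu> \<nu> :: "'s::finite pmf"
  assumes "set_pmf \<nu> = UNIV" "\<mu> \<noteq> \<nu>"
  shows "KL_div \<mu> \<nu> > 0"
proof -
  have "TV_dist \<mu> \<nu> \<noteq> 0"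
  proof
    assume "TV_dist \<mu> \<nu> = 0"
    then have "\<forall>x. pmf \<mu> x = pmf \<nu> x" by (simp add: TV_dist_def sum_nonneg_eq_0_iff)
    then show False using assms(2) by (simp add: pmf_eq_iff)
  qed
  then have "0 < (TV_dist \<mu> \<nu>)\<^sup>2" by simp
  then show ?thesis using pinsker[OF assms(1), of \<mu>] by linarith
qed

section \<open>Data processing and contraction of the divergence\<close>

lemma KL_div_self: "set_pmf \<pi> = UNIV \<Longrightarrow> KL_div \<pi> \<pi> = 0"
  by (simp add: KL_div_def less_imp_neq[OF pmf_pos_full_support, symmetric])

text \<open>
  The tangent of \<open>u * ln u\<close> at \<open>c\<close>. Taking \<open>u\<close> and \<open>c\<close> to be the likelihood ratios before and
  after the step and summing against \<open>\<pi>(x) P(x,y)\<close> gives data processing.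
\<close>

lemma tangent_x_ln_x:
  fixes u c :: real
  assumes "u \<ge> 0" "c > 0"
  shows "u * ln c + u - c \<le> u * ln u"
proof (cases "u = 0")
  case False
  then have u: "u > 0" using assms by simp
  have "ln (c / u) \<le> c / u - 1" using u assms by (intro ln_le_minus_one) simp
  then have "u * (ln c - ln u) \<le> u * (c / u - 1)"
    using u assms by (intro mult_left_mono) (auto simp: ln_div)
  then show ?thesis using u by (simp add: algebra_simps)
qed (use assms in simp)

lemma KL_div_data_processing:
  fixes \<mu> \<pi> :: "'s::finite pmf"
  assumes "set_pmf \<pi> = UNIV" "stationary \<pi> P"
  shows "KL_div (bind_pmf \<mu> P) \<pi> \<le> KL_div \<mu> \<pi>"
proof -
  note pos = pmf_pos_full_support[OF assms(1)]
  define \<nu> where "\<nu> = bind_pmf \<mu> P"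
  have \<nu>: "pmf \<nu> y = (\<Sum>x\<in>UNIV. pmf \<mu> x * pmf (P x) y)" for y
    by (simp add: \<nu>_def pmf_bind_finite)
  have st: "(\<Sum>x\<in>UNIV. pmf \<pi> x * pmf (P x) y) = pmf \<pi> y" for y
    using assms(2) pmf_bind_finite[of \<pi> P y] by (simp add: stationary_def)
  have "pmf \<nu> y * ln (pmf \<nu> y / pmf \<pi> y)
      \<le> (\<Sum>x\<in>UNIV. pmf \<mu> x * pmf (P x) y * ln (pmf \<mu> x / pmf \<pi> x))" for y
  \<comment> \<open>A tangent point must be positive. If \<nu>(y) = 0, every \<mu>(x) P(x,y) is 0
    and both sides vanish.\<close>
  proof (cases "pmf \<nu> y = 0")
    case True
    then have "pmf \<mu> x * pmf (P x) y = 0" for x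
      using \<nu>[of y] by (simp add: sum_nonneg_eq_0_iff)
    then show ?thesis unfolding True by (simp only: mult_zero_left sum.neutral_const order_refl)
  next
    case False
    define c where "c = pmf \<nu> y / pmf \<pi> y"
    have c: "c > 0" using False pos by (simp add: c_def less_le)
    have "pmf \<mu> x * pmf (P x) y * ln c + pmf \<mu> x * pmf (P x) y - c * (pmf \<pi> x * pmf (P x) y)
        \<le> pmf \<mu> x * pmf (P x) y * ln (pmf \<mu> x / pmf \<pi> x)" for x
    proof -
      define u where "u = pmf \<mu> x / pmf \<pi> x"
      have m: "pmf \<mu> x = pmf \<pi> x * u" using pos[of x] by (simp add: u_def)
      have "u * ln c + u - c \<le> u * ln u" by (rule tangent_x_ln_x) (use c in \<open>simp_all add: u_def\<close>)
      then have "(pmf \<pi> x * pmf (P x) y) * (u * ln c + u - c) \<le> (pmf \<pi> x * pmf (P x) y) * (u * ln u)"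
        by (intro mult_left_mono) auto
      then show ?thesis unfolding u_def[symmetric] m by (simp add: algebra_simps)
    qed
    then have "(\<Sum>x\<in>UNIV. pmf \<mu> x * pmf (P x) y * ln c + pmf \<mu> x * pmf (P x) y
          - c * (pmf \<pi> x * pmf (P x) y))
        \<le> (\<Sum>x\<in>UNIV. pmf \<mu> x * pmf (P x) y * ln (pmf \<mu> x / pmf \<pi> x))"
      by (intro sum_mono)
    \<comment> \<open>Stationarity sums \<pi>(x) P(x,y) to \<pi>(y). With the choice of
      \<open>c\<close>, the last two terms cancel and only \<open>pmf \<nu> y * ln c\<close>
      remains.\<close>
    moreover have "(\<Sum>x\<in>UNIV. pmf \<mu> x * pmf (P x) y * ln c + pmf \<mu> x * pmf (P x) y
          - c * (pmf \<pi> x * pmf (P x) y)) = pmf \<nu> y * ln c + pmf \<nu> y - c * pmf \<pi> y"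
      by (simp add: sum.distrib sum_subtractf sum_distrib_right[symmetric]
          sum_distrib_left[symmetric] \<nu> st)
    moreover have "c * pmf \<pi> y = pmf \<nu> y" using pos[of y] by (simp add: c_def)
    ultimately show ?thesis by (simp add: c_def)
  qed
  then have "KL_div \<nu> \<pi> \<le> (\<Sum>y\<in>UNIV. \<Sum>x\<in>UNIV. pmf \<mu> x * pmf (P x) y * ln (pmf \<mu> x / pmf \<pi> x))"
    unfolding KL_div_def by (intro sum_mono)
  also have "\<dots> = (\<Sum>x\<in>UNIV. \<Sum>y\<in>UNIV. pmf \<mu> x * ln (pmf \<mu> x / pmf \<pi> x) * pmf (P x) y)"
    by (subst sum.swap) (simp add: mult_ac)
  \<comment> \<open>Each row of P sums to 1.\<close>
  also have "\<dots> = KL_div \<mu> \<pi>"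
    by (simp add: KL_div_def sum_distrib_left[symmetric] sum_pmf_UNIV)
  finally show ?thesis by (simp add: \<nu>_def)
qed

lemma KL_div_contraction:
  fixes \<mu> \<pi> :: "'s::finite pmf"
  assumes "set_pmf \<pi> = UNIV" "stationary \<pi> P"
  shows "KL_div (bind_pmf \<mu> P) \<pi> \<le> eta_KL \<pi> P * KL_div \<mu> \<pi>"
proof (cases "\<mu> = \<pi>")
  \<comment> \<open>The supremum omits \<open>\<mu> = \<pi>\<close>, where stationarity makes both
    sides 0.\<close>
  case True
  then show ?thesis using assms by (simp add: stationary_def KL_div_self)
next
  case False
  note pos = KL_div_pos[OF assms(1)]
  \<comment> \<open>A real supremum dominates its members only if the set is bounded; data
    processing gives the bound 1.\<close>
  have "bdd_above ((\<lambda>\<mu>. KL_div (bind_pmf \<mu> P) \<pi> / KL_div \<mu> \<pi>) ` {\<mu>. \<mu> \<noteq> \<pi>})"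
    by (rule bdd_aboveI2[of _ _ 1]) (use pos KL_div_data_processing[OF assms] in simp)
  then have "KL_div (bind_pmf \<mu> P) \<pi> / KL_div \<mu> \<pi> \<le> eta_KL \<pi> P"
    unfolding eta_KL_def using False by (intro cSUP_upper) auto
  then show ?thesis using pos[OF False] by (simp add: pos_divide_le_eq)
qed

lemma KL_div_return_pmf: "KL_div (return_pmf x) \<pi> = ln (1 / pmf \<pi> x)"
proof -
  have "KL_div (return_pmf x) \<pi> = (\<Sum>y\<in>UNIV. if y = x then ln (1 / pmf \<pi> y) else 0)"
    unfolding KL_div_def by (intro sum.cong) (auto simp: pmf_return)
  then show ?thesis by simp
qed

text \<open>\<open>kernel_power\<close> applies P last, so the contraction acts on the law at time
  \<open>t\<close>; nonnegativity of \<eta> then lets the induction hypothesis be multiplied by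
  it.\<close>

lemma KL_div_kernel_power:
  fixes \<pi> :: "'s::finite pmf"
  assumes "set_pmf \<pi> = UNIV" "stationary \<pi> P" "0 \<le> eta_KL \<pi> P"
  shows "KL_div (kernel_power P t x) \<pi> \<le> eta_KL \<pi> P ^ t * ln (1 / pi_min \<pi>)"
proof (induction t)
  case 0
  have "pi_min \<pi> \<le> pmf \<pi> x" by (simp add: pi_min_def)
  moreover have "0 < pi_min \<pi>"
    using pmf_pos_full_support[OF assms(1)] by (auto simp: pi_min_def)
  ultimately show ?case
    using pmf_pos_full_support[OF assms(1), of x] by (simp add: KL_div_return_pmf ln_div)
next
  case (Suc t)
  have "KL_div (kernel_power P (Suc t) x) \<pi> \<le> eta_KL \<pi> P * KL_div (kernel_power P t x) \<pi>"
    using KL_div_contraction[OF assms(1,2)] by simp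
  also have "\<dots> \<le> eta_KL \<pi> P * (eta_KL \<pi> P ^ t * ln (1 / pi_min \<pi>))"
    by (rule mult_left_mono[OF Suc assms(3)])
  finally show ?case by (simp add: mult.assoc)
qed

section \<open>From divergence to mixing time\<close>

lemma t_mix_le_if_KL_bound:
  fixes \<pi> :: "'s::finite pmf"
  assumes "set_pmf \<pi> = UNIV" "stationary \<pi> P" "0 \<le> eta_KL \<pi> P" "0 < \<epsilon>"
    and "eta_KL \<pi> P ^ t * ln (1 / pi_min \<pi>) \<le> 2 * \<epsilon>\<^sup>2"
  shows "t_mix \<pi> P \<epsilon> \<le> t"
proof -
  have "TV_dist (kernel_power P t x) \<pi> \<le> \<epsilon>" for x
  proof -
    have "(TV_dist (kernel_power P t x) \<pi>)\<^sup>2 \<le> \<epsilon>\<^sup>2"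
      using pinsker[OF assms(1), of "kernel_power P t x"]
        KL_div_kernel_power[OF assms(1-3), of t x] assms(5) by linarith
    then show ?thesis by (rule power2_le_imp_le) (use assms(4) in simp)
  qed
  then show ?thesis unfolding t_mix_def by (intro Least_le) auto
qed

text \<open>A second state takes positive mass, so no state has mass 1. Hence
  \<open>ln (1 / pi_min \<pi>)\<close> is positive and its logarithm is meaningful.\<close>

lemma pi_min_less_1:
  fixes \<pi> :: "'s::finite pmf"
  assumes "CARD('s) \<ge> 2" "set_pmf \<pi> = UNIV"
  shows "pi_min \<pi> < 1"
proof -
  obtain x y :: 's where xy: "x \<noteq> y"
    using assms(1) card_le_Suc0_iff_eq[of "UNIV :: 's set"] by force
  have "pmf \<pi> x + pmf \<pi> y \<le> 1"
    using sum_mono2[of UNIV "{x, y}" "pmf \<pi>"] xy by (simp add: sum_pmf_UNIV)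
  then have "pmf \<pi> x < 1" using pmf_pos_full_support[OF assms(2), of y] by linarith
  moreover have "pi_min \<pi> \<le> pmf \<pi> x" by (simp add: pi_min_def)
  ultimately show ?thesis by linarith
qed

lemma power_mult_le_if_log_bound:
  fixes \<eta> L \<delta> :: real
  assumes "0 < \<eta>" "\<eta> < 1" "0 < L" "0 < \<delta>" "ln (L / \<delta>) / (- ln \<eta>) \<le> real t"
  shows "\<eta> ^ t * L \<le> \<delta>"
proof -
  \<comment> \<open>Clearing the denominator keeps the direction because \<open>- ln \<eta>\<close>
    is positive for \<open>\<eta> < 1\<close>.\<close>
  have "ln (L / \<delta>) \<le> real t * (- ln \<eta>)"
    using assms(1,2,5) by (subst (asm) pos_divide_le_eq) auto
  then have "ln (\<eta> ^ t * L) \<le> ln \<delta>" using assms by (simp add: ln_div ln_mult ln_realpow)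
  then show ?thesis using assms by simp
qed

theorem theorem8p1:
  fixes P :: "'s::finite \<Rightarrow> 's pmf" and \<pi> :: "'s pmf" and \<epsilon> :: real
  assumes "CARD('s) \<ge> 2"
    and "ergodic_kernel P"
    and "stationary \<pi> P"
    and "set_pmf \<pi> = UNIV"
    and "0 < \<epsilon>" and "\<epsilon> < 1"
  shows "(0 < eta_KL \<pi> P \<and> eta_KL \<pi> P < 1 \<longrightarrow>
            int (t_mix \<pi> P \<epsilon>) \<le>
              max 0 \<lceil>ln (1 / (2 * \<epsilon>\<^sup>2) * ln (1 / pi_min \<pi>)) / (- ln (eta_KL \<pi> P))\<rceil>)
       \<and> (eta_KL \<pi> P = 0 \<longrightarrow> t_mix \<pi> P \<epsilon> \<le> 1)"
proof (intro conjI impI)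
  assume \<eta>: "0 < eta_KL \<pi> P \<and> eta_KL \<pi> P < 1"
  define L where "L = ln (1 / pi_min \<pi>)"
  define r where "r = ln (1 / (2 * \<epsilon>\<^sup>2) * L) / (- ln (eta_KL \<pi> P))"
  have "0 < pi_min \<pi>"
    using pmf_pos_full_support[OF assms(4)] by (auto simp: pi_min_def)
  then have "0 < L"
    using pi_min_less_1[OF assms(1,4)] by (simp add: L_def)
  \<comment> \<open>\<open>nat\<close> sends a negative ceiling to 0, which is the
    \<open>max 0\<close> of the claim and still bounds \<open>r\<close> from above.\<close>
  moreover have "ln (L / (2 * \<epsilon>\<^sup>2)) / (- ln (eta_KL \<pi> P)) \<le> real (nat \<lceil>r\<rceil>)"
    using real_nat_ceiling_ge[of r] by (simp add: r_def)
  ultimately have "eta_KL \<pi> P ^ nat \<lceil>r\<rceil> * L \<le> 2 * \<epsilon>\<^sup>2"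
    using \<eta> assms(5) by (intro power_mult_le_if_log_bound) auto
  then have "t_mix \<pi> P \<epsilon> \<le> nat \<lceil>r\<rceil>"
    using \<eta> assms unfolding L_def by (intro t_mix_le_if_KL_bound) auto
  then show "int (t_mix \<pi> P \<epsilon>) \<le>
      max 0 \<lceil>ln (1 / (2 * \<epsilon>\<^sup>2) * ln (1 / pi_min \<pi>)) / (- ln (eta_KL \<pi> P))\<rceil>"
    unfolding L_def[symmetric] r_def[symmetric] by linarith
next
  assume "eta_KL \<pi> P = 0"
  \<comment> \<open>At \<open>t = 1\<close> the factor \<open>0 ^ t\<close> is 0; at
    \<open>t = 0\<close> it would be 1.\<close>
  then show "t_mix \<pi> P \<epsilon> \<le> 1"
    using assms by (intro t_mix_le_if_KL_bound) auto
qed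

end
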